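(* For any fixed $r\in(0,1)$, $$\log\left(1-\frac{\operatorname{Vol}(\mathcal{E}_n(r))}{\operatorname{Vol}(\mathcal{E}_n)}\right)=-\frac{n}{2}\left|\log(1-r^2)\right|+O(\log n),\qquad\text{as }n\rightarrow\infty.$$
   Context: $\mathcal{E}_n=\{C\in\mathbb{R}^{n\times n}: C=C',\ C\succeq 0,\ C_{ii}=1 \text{ for all } i\}$ is the set of $n\times n$ correlation matrices, and for $r\in[0,1]$, $\mathcal{E}_n(r)=\{C\in\mathcal{E}_n:\max_{i<j}|C_{ij}|\leq r\}$. $\operatorname{Vol}$ denotes $d$-dimensional Lebesgue measure, $d=n(n-1)/2$, in the off-diagonal coordinates $(C_{ij})_{i<j}$. *)

theory Defs
  imports
    "HOL-Analysis.Analysis"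
    "HOL-Library.Landau_Symbols"
    "Jordan_Normal_Form.Matrix"
begin

definition psd_mat :: "nat \<Rightarrow> real mat \<Rightarrow> bool" where
  "psd_mat n C \<longleftrightarrow> (\<forall>v \<in> carrier_vec n. 0 \<le> scalar_prod v (C *\<^sub>v v))"

definition correlation_matrices :: "nat \<Rightarrow> real mat set" where
  "correlation_matrices n =
    {C \<in> carrier_mat n n. C = transpose_mat C \<and> psd_mat n C \<and> (\<forall>i<n. C $$ (i, i) = 1)}"

definition bounded_correlation_matrices :: "nat \<Rightarrow> real \<Rightarrow> real mat set" where
  "bounded_correlation_matrices n r =
    {C \<in> correlation_matrices n. \<forall>i j. i < j \<and> j < n \<longrightarrow> \<bar>C $$ (i, j)\<bar> \<le> r}"

definition upper_indices :: "nat \<Rightarrow> (nat \<times> nat) set" where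
  "upper_indices n = {(i, j). i < j \<and> j < n}"

definition upper_coords :: "nat \<Rightarrow> real mat \<Rightarrow> nat \<times> nat \<Rightarrow> real" where
  "upper_coords n C = (\<lambda>p \<in> upper_indices n. C $$ p)"

(* The product of lborel over the n(n-1)/2 upper index pairs is Lebesgue measure on the Borel
   sets of the coordinate space; the sets of correlation matrices above are closed there,
   so completing the measure would make no difference. *)
definition corr_vol :: "nat \<Rightarrow> real mat set \<Rightarrow> real" where
  "corr_vol n S = measure (Pi\<^sub>M (upper_indices n) (\<lambda>_. lborel)) (upper_coords n ` S)"

end

(* The volume ratio complement is the probability that some entry of a uniformly random
   correlation matrix exceeds r in modulus. Fix one entry C_pq = y. Replacing row and column q
   by y (row p) + sqrt (1 - y^2) (row q) is a congruence, hence preserves positive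
   semidefiniteness; it carries the slice C_pq = 0 onto the slice C_pq = y and acts on the
   n - 2 free entries of row q as a shear followed by a scaling. So the slice volume is
   proportional to (1 - y^2)^((n-2)/2), and P(|C_pq| > r) equals (1 - r^2)^(n/2) up to factors
   polynomial in n. A union bound over the pairs (p, q) costs another polynomial factor, which
   is absorbed in O(log n). *)
theory Submission
  imports Defs
begin

section \<open>Shears on finite products of Lebesgue measure\<close>

interpretation lborel_prod: product_sigma_finite "\<lambda>_. lborel :: real measure" ..

abbreviation lebesgue_prod :: "'i set \<Rightarrow> ('i \<Rightarrow> real) measure" where
  "lebesgue_prod I \<equiv> Pi\<^sub>M I (\<lambda>_. lborel)"

lemma measurable_shear1:
  assumes "e \<in> J" "f \<in> J"
  shows "(\<lambda>x. x(e := a * x e + b * x f)) \<in> measurable (lebesgue_prod J) (lebesgue_prod J)"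
proof (rule measurable_fun_upd[where J = J])
  show "J = J \<union> {e}" using assms by auto
  have [measurable]: "(\<lambda>x. x e) \<in> borel_measurable (lebesgue_prod J)" "(\<lambda>x. x f) \<in> borel_measurable (lebesgue_prod J)"
    using measurable_component_singleton[of _ J "\<lambda>_. lborel :: real measure"] assms by auto
  show "(\<lambda>x. a * x e + b * x f) \<in> measurable (lebesgue_prod J) lborel"
    by simp
qed simp

text \<open>By Tonelli, coordinate \<open>e\<close> can be integrated innermost. As \<open>f\<close>
  differs from \<open>e\<close>, the term \<open>b * x f\<close> is constant there, so what remains
  is a one-dimensional affine substitution with Jacobian \<open>a\<close>.\<close>

lemma nn_integral_shear1:
  assumes J: "finite J" "e \<in> J" "f \<in> J" "f \<noteq> e" and a: "0 < a"
    and g: "g \<in> borel_measurable (lebesgue_prod J)"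
  shows "ennreal a * (\<integral>\<^sup>+x. g (x(e := a * x e + b * x f)) \<partial>lebesgue_prod J)
       = (\<integral>\<^sup>+x. g x \<partial>lebesgue_prod J)"
proof -
  define L where "L = J - {e}"
  have L: "finite L" "e \<notin> L" "J = insert e L" "f \<in> L" using J by (auto simp: L_def)
  have g': "g \<in> borel_measurable (lebesgue_prod (insert e L))" using g L by simp
  have m: "(\<lambda>x. g (x(e := a * x e + b * x f))) \<in> borel_measurable (lebesgue_prod (insert e L))"
    using measurable_compose[OF measurable_shear1 g] J L by simp
  have sec: "(\<lambda>y. g (x(e := y))) \<in> borel_measurable borel" if "x \<in> space (lebesgue_prod L)" for x
    using measurable_compose[OF measurable_component_update[OF that L(2)] g'] by simp
  have meas: "(\<lambda>x. \<integral>\<^sup>+y. g (x(e := a * y + b * x f)) \<partial>lborel) \<in> borel_measurable (lebesgue_prod L)"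
  proof -
    have "(\<lambda>p. g ((fst p)(e := a * snd p + b * fst p f)))
        \<in> borel_measurable (lebesgue_prod L \<Otimes>\<^sub>M lborel)"
    proof (rule measurable_compose[OF _ g'], rule measurable_fun_upd[where J = L])
      have [measurable]: "(\<lambda>x. x f) \<in> borel_measurable (lebesgue_prod L)"
        using measurable_component_singleton[of f L "\<lambda>_. lborel :: real measure"] L by auto
      show "(\<lambda>p. a * snd p + b * fst p f) \<in> measurable (lebesgue_prod L \<Otimes>\<^sub>M lborel) lborel"
        by simp
    qed auto
    from lborel.borel_measurable_nn_integral_fst[OF this] show ?thesis by simp
  qed
  have "ennreal a * (\<integral>\<^sup>+x. g (x(e := a * x e + b * x f)) \<partial>lebesgue_prod J)
      = ennreal a * (\<integral>\<^sup>+x. \<integral>\<^sup>+y. g (x(e := a * y + b * x f)) \<partial>lborel \<partial>lebesgue_prod L)"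
    using L(4,2) unfolding L(3) lborel_prod.product_nn_integral_insert[OF L(1,2) m]
    by (auto intro!: arg_cong2[of _ _ _ _ "(*)"] nn_integral_cong)
  also have "\<dots> = (\<integral>\<^sup>+x. ennreal a * (\<integral>\<^sup>+y. g (x(e := a * y + b * x f)) \<partial>lborel) \<partial>lebesgue_prod L)"
    by (rule nn_integral_cmult[symmetric, OF meas])
  also have "\<dots> = (\<integral>\<^sup>+x. \<integral>\<^sup>+y. g (x(e := y)) \<partial>lborel \<partial>lebesgue_prod L)"
  proof (rule nn_integral_cong)
    fix x assume x: "x \<in> space (lebesgue_prod L)"
    show "ennreal a * (\<integral>\<^sup>+y. g (x(e := a * y + b * x f)) \<partial>lborel) = (\<integral>\<^sup>+y. g (x(e := y)) \<partial>lborel)"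
      using nn_integral_real_affine[OF sec[OF x], of a "b * x f"] a by (simp add: add.commute)
  qed
  also have "\<dots> = (\<integral>\<^sup>+x. g x \<partial>lebesgue_prod J)"
    unfolding L(3) lborel_prod.product_nn_integral_insert[OF L(1,2) g'] ..
  finally show ?thesis .
qed

text \<open>Every source coordinate \<open>\<phi> e\<close> lies outside \<open>K\<close> and is
  never altered. The simultaneous update is therefore a composition of single shears in any order,
  each contributing one factor \<open>a\<close>; induction on \<open>K\<close> peels them
  off.\<close>

lemma nn_integral_shear:
  assumes "finite K" and J: "finite J" "K \<subseteq> J" and \<phi>: "\<And>e. e \<in> K \<Longrightarrow> \<phi> e \<in> J - K" and a: "0 < a"
    and "g \<in> borel_measurable (lebesgue_prod J)"
  shows "ennreal a ^ card K *
      (\<integral>\<^sup>+x. g (\<lambda>e. if e \<in> K then a * x e + b * x (\<phi> e) else x e) \<partial>lebesgue_prod J)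
    = (\<integral>\<^sup>+x. g x \<partial>lebesgue_prod J)"
  using assms(1) J(2) \<phi> assms(6)
proof (induction K arbitrary: g rule: finite_induct)
  case empty
  then show ?case by simp
next
  case (insert k K)
  define h where "h x = g (x(k := a * x k + b * x (\<phi> k)))" for x
  have k: "k \<in> J" "\<phi> k \<in> J" "\<phi> k \<noteq> k" "\<phi> k \<notin> K" using insert.prems by auto
  have h: "h \<in> borel_measurable (lebesgue_prod J)"
    unfolding h_def by (rule measurable_compose[OF measurable_shear1 insert.prems(3)]) (use k in auto)
  have eq: "g (\<lambda>e. if e \<in> insert k K then a * x e + b * x (\<phi> e) else x e)
      = h (\<lambda>e. if e \<in> K then a * x e + b * x (\<phi> e) else x e)" for x
    using insert.hyps k by (auto simp: h_def intro!: arg_cong[of _ _ g])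
  have "ennreal a ^ card (insert k K) *
      (\<integral>\<^sup>+x. g (\<lambda>e. if e \<in> insert k K then a * x e + b * x (\<phi> e) else x e) \<partial>lebesgue_prod J)
    = ennreal a * (ennreal a ^ card K *
      (\<integral>\<^sup>+x. h (\<lambda>e. if e \<in> K then a * x e + b * x (\<phi> e) else x e) \<partial>lebesgue_prod J))"
    unfolding eq using insert.hyps by (simp add: mult.assoc)
  also have "\<dots> = ennreal a * (\<integral>\<^sup>+x. h x \<partial>lebesgue_prod J)"
    using insert.prems by (subst insert.IH[OF _ _ h]) auto
  also have "\<dots> = (\<integral>\<^sup>+x. g x \<partial>lebesgue_prod J)"
    unfolding h_def by (rule nn_integral_shear1) (use J k a insert.prems in auto)
  finally show ?case .
qed

section \<open>Congruence by a row and column operation\<close>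

text \<open>The hypotheses say that M' = T'MT, where T sends v to the vector with
  \<open>v p + y * v q\<close> at p and \<open>a * v q\<close> at q. Hence the form of M' at v is
  the form of M at Tv.\<close>

lemma sum_row_operation:
  fixes M M' :: "nat \<Rightarrow> nat \<Rightarrow> real"
  assumes pq: "p < n" "q < n" "p \<noteq> q"
    and sym: "\<And>i j. M i j = M j i" "\<And>i j. M' i j = M' j i"
    and off: "\<And>i j. i < n \<Longrightarrow> j < n \<Longrightarrow> i \<noteq> q \<Longrightarrow> j \<noteq> q \<Longrightarrow> M' i j = M i j"
    and row: "\<And>j. j < n \<Longrightarrow> j \<noteq> q \<Longrightarrow> M' q j = y * M p j + a * M q j"
    and diag: "M' q q = y\<^sup>2 * M p p + 2 * a * y * M p q + a\<^sup>2 * M q q"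
  shows "(\<Sum>i<n. \<Sum>j<n. M' i j * v i * v j)
       = (\<Sum>i<n. \<Sum>j<n. M i j * (v(p := v p + y * v q, q := a * v q)) i
                                * (v(p := v p + y * v q, q := a * v q)) j)"
proof -
  define S where "S = {..<n} - {q}"
  define t where "t = y * v q"
  define w where "w = v(p := v p + y * v q, q := a * v q)"
  have S: "finite S" "q \<notin> S" "{..<n} = insert q S" "p \<in> S" using pq by (auto simp: S_def)
  \<comment> \<open>M and M' differ only in row and column \<open>q\<close>, so these are split off.
    On the remaining indices \<open>S\<close>, the vectors \<open>v\<close> and \<open>w\<close>
    differ only at \<open>p\<close>, by \<open>t\<close>.\<close>
  have split: "(\<Sum>i<n. \<Sum>j<n. N i j * u i * u j)
      = N q q * (u q)\<^sup>2 + 2 * u q * (\<Sum>j\<in>S. N q j * u j) + (\<Sum>i\<in>S. \<Sum>j\<in>S. N i j * u i * u j)"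
    if N: "\<And>i j. N i j = N j i" for N :: "nat \<Rightarrow> nat \<Rightarrow> real" and u
  proof -
    have "(\<Sum>i\<in>S. N i q * u i * u q) = u q * (\<Sum>j\<in>S. N q j * u j)"
      by (simp add: sum_distrib_left mult_ac N[of _ q])
    moreover have "(\<Sum>j\<in>S. N q j * u q * u j) = u q * (\<Sum>j\<in>S. N q j * u j)"
      by (simp add: sum_distrib_left mult_ac)
    ultimately show ?thesis
      unfolding S(3) using S by (simp add: sum.distrib power2_eq_square)
  qed
  have w: "w q = a * v q" "\<And>i. i \<in> S \<Longrightarrow> w i = v i + (if i = p then t else 0)"
    using S(2) pq by (auto simp: w_def t_def)
  have row_sum: "(\<Sum>j\<in>S. N j * w j) = (\<Sum>j\<in>S. N j * v j) + t * N p" for N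
  proof -
    have "(\<Sum>j\<in>S. N j * w j) = (\<Sum>j\<in>S. N j * v j + (if j = p then N p * t else 0))"
      by (rule sum.cong) (auto simp: w algebra_simps)
    then show ?thesis using S by (simp add: sum.distrib mult.commute)
  qed
  define R where "R = (\<Sum>j\<in>S. M p j * v j)"
  have "(\<Sum>i\<in>S. \<Sum>j\<in>S. M i j * w i * w j) = (\<Sum>i\<in>S. (\<Sum>j\<in>S. M i j * w j) * w i)"
    by (simp add: sum_distrib_left sum_distrib_right mult_ac)
  also have "\<dots> = (\<Sum>i\<in>S. (\<Sum>j\<in>S. M i j * v j) * v i) + t * R + t * ((\<Sum>i\<in>S. M i p * v i) + t * M p p)"
    unfolding row_sum[of "\<lambda>i. \<Sum>j\<in>S. M i j * w j"]
    unfolding row_sum[of "M p"] row_sum[of "M i" for i] R_def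
    by (simp add: sum.distrib distrib_right sum_distrib_left distrib_left mult_ac)
  also have "(\<Sum>i\<in>S. M i p * v i) = R"
    unfolding R_def by (simp add: sym(1)[of _ p])
  also have "(\<Sum>i\<in>S. (\<Sum>j\<in>S. M i j * v j) * v i) = (\<Sum>i\<in>S. \<Sum>j\<in>S. M i j * v i * v j)"
    by (simp add: sum_distrib_left sum_distrib_right mult_ac)
  finally have quad: "(\<Sum>i\<in>S. \<Sum>j\<in>S. M i j * w i * w j)
      = (\<Sum>i\<in>S. \<Sum>j\<in>S. M i j * v i * v j) + 2 * t * R + t\<^sup>2 * M p p"
    by (simp add: algebra_simps power2_eq_square)
  have "(\<Sum>j\<in>S. M' q j * v j) = (\<Sum>j\<in>S. y * (M p j * v j) + a * (M q j * v j))"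
  proof (rule sum.cong)
    fix j assume "j \<in> S"
    then have "j < n" "j \<noteq> q" by (auto simp: S_def)
    then show "M' q j * v j = y * (M p j * v j) + a * (M q j * v j)"
      by (simp add: row algebra_simps)
  qed simp
  then have 1: "(\<Sum>j\<in>S. M' q j * v j) = y * R + a * (\<Sum>j\<in>S. M q j * v j)"
    by (simp add: R_def sum.distrib sum_distrib_left)
  have 2: "(\<Sum>i\<in>S. \<Sum>j\<in>S. M' i j * v i * v j) = (\<Sum>i\<in>S. \<Sum>j\<in>S. M i j * v i * v j)"
    by (intro sum.cong refl) (auto simp: S_def off)
  show ?thesis
    unfolding split[OF sym(1)] split[OF sym(2)] w_def[symmetric] quad w(1) 1 2 diag
    unfolding row_sum
    by (simp add: t_def algebra_simps power2_eq_square sym(1)[of q p])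
qed

section \<open>Correlation matrices in upper triangular coordinates\<close>

text \<open>A total function on all index pairs makes symmetry unconditional, which is the form in
  which \<open>sum_row_operation\<close> asks for it.\<close>

definition entry :: "(nat \<times> nat \<Rightarrow> real) \<Rightarrow> nat \<Rightarrow> nat \<Rightarrow> real" where
  "entry c i j = (if i = j then 1 else c (min i j, max i j))"

definition corr_form :: "nat \<Rightarrow> (nat \<times> nat \<Rightarrow> real) \<Rightarrow> (nat \<Rightarrow> real) \<Rightarrow> real" where
  "corr_form n c v = (\<Sum>i<n. \<Sum>j<n. entry c i j * v i * v j)"

text \<open>Extensionality fixes the values outside \<open>upper_indices n\<close>, as in the space
  of the product measure and in the image of \<open>upper_coords\<close>.\<close>

definition corr_coords :: "nat \<Rightarrow> (nat \<times> nat \<Rightarrow> real) set" where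
  "corr_coords n = {c \<in> extensional (upper_indices n). \<forall>v. 0 \<le> corr_form n c v}"

lemma entry_commute: "entry c i j = entry c j i"
  by (simp add: entry_def min.commute max.commute)

lemma finite_upper_indices [simp]: "finite (upper_indices n)"
  by (rule finite_subset[of _ "{..<n} \<times> {..<n}"]) (auto simp: upper_indices_def)

lemma upper_coords_bounded:
  "upper_coords n ` bounded_correlation_matrices n r
     = {c \<in> upper_coords n ` correlation_matrices n. \<forall>e\<in>upper_indices n. \<bar>c e\<bar> \<le> r}"
proof -
  have "(\<forall>i j. i < j \<and> j < n \<longrightarrow> \<bar>C $$ (i, j)\<bar> \<le> r)
      \<longleftrightarrow> (\<forall>e\<in>upper_indices n. \<bar>upper_coords n C e\<bar> \<le> r)" for C
    by (auto simp: upper_coords_def upper_indices_def)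
  then show ?thesis
    by (auto simp: bounded_correlation_matrices_def)
qed

text \<open>This removes the matrix type from the problem: from here on, volumes are measures of
  \<open>corr_coords n\<close>. The inverse of \<open>upper_coords\<close> rebuilds a matrix from
  \<open>entry\<close>.\<close>

lemma upper_coords_correlation:
  "upper_coords n ` correlation_matrices n = corr_coords n"
proof (intro equalityI subsetI)
  fix c assume "c \<in> upper_coords n ` correlation_matrices n"
  then obtain C where C: "C \<in> carrier_mat n n" "C = transpose_mat C" "psd_mat n C"
      "\<forall>i<n. C $$ (i, i) = 1" and c: "c = upper_coords n C"
    by (auto simp: correlation_matrices_def)
  have sym: "C $$ (i, j) = C $$ (j, i)" if "i < n" "j < n" for i j
    using C(1) that by (subst C(2)) auto
  have ent: "entry c i j = C $$ (i, j)" if "i < n" "j < n" for i j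
    using that C(4) sym[OF that]
    by (cases i j rule: linorder_cases) (auto simp: entry_def c upper_coords_def upper_indices_def)
  have "0 \<le> corr_form n c v" for v
  proof -
    have "0 \<le> scalar_prod (vec n v) (C *\<^sub>v vec n v)"
      using C(3) by (auto simp: psd_mat_def)
    also have "\<dots> = corr_form n c v"
      using C(1) by (auto simp: scalar_prod_def corr_form_def sum_distrib_left ent atLeast0LessThan
            intro!: sum.cong)
    finally show ?thesis .
  qed
  then show "c \<in> corr_coords n"
    by (auto simp: corr_coords_def c upper_coords_def)
next
  fix c assume c: "c \<in> corr_coords n"
  define C where "C = mat n n (\<lambda>(i, j). entry c i j)"
  have "upper_coords n C = c"
    using c by (auto simp: corr_coords_def upper_coords_def C_def fun_eq_iff upper_indices_def
          entry_def extensional_def restrict_def)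
  moreover have "psd_mat n C"
    unfolding psd_mat_def
  proof
    fix v :: "real vec" assume v: "v \<in> carrier_vec n"
    have "0 \<le> corr_form n c (\<lambda>i. v $ i)" using c by (auto simp: corr_coords_def)
    also have "\<dots> = scalar_prod v (C *\<^sub>v v)"
      using v by (auto simp: scalar_prod_def corr_form_def sum_distrib_left C_def atLeast0LessThan
            intro!: sum.cong)
    finally show "0 \<le> scalar_prod v (C *\<^sub>v v)" .
  qed
  moreover have "C = transpose_mat C"
    by (rule eq_matI) (auto simp: C_def entry_commute)
  moreover have "C \<in> carrier_mat n n" "\<forall>i<n. C $$ (i, i) = 1"
    by (auto simp: C_def entry_def)
  ultimately show "c \<in> upper_coords n ` correlation_matrices n"
    unfolding correlation_matrices_def by blast
qed

lemma corr_form_single_pair: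
  assumes "p < q" "q < n"
  shows "corr_form n c (\<lambda>i. if i = p then s else if i = q then t else 0)
       = s\<^sup>2 + 2 * s * t * c (p, q) + t\<^sup>2"
proof -
  let ?v = "\<lambda>i. if i = p then s else if i = q then t else 0"
  have *: "(\<Sum>i<n. f i * ?v i) = f p * s + f q * t" for f
  proof -
    have "(\<Sum>i<n. f i * ?v i) = (\<Sum>i\<in>{p, q}. f i * ?v i)"
      by (rule sum.mono_neutral_right) (use assms in auto)
    then show ?thesis using assms by auto
  qed
  have "corr_form n c ?v = (\<Sum>i<n. (\<Sum>j<n. entry c i j * ?v j) * ?v i)"
    unfolding corr_form_def by (simp only: sum_distrib_left sum_distrib_right mult_ac)
  also have "\<dots> = s\<^sup>2 + 2 * s * t * c (p, q) + t\<^sup>2"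
    unfolding * using assms by (simp add: entry_def min_def max_def algebra_simps power2_eq_square)
  finally show ?thesis .
qed

text \<open>Testing the form on the sum and the difference of the basis vectors at p and q gives 2 +
  2c >= 0 and 2 - 2c >= 0 for the entry c.\<close>

lemma corr_coords_abs_le_1:
  assumes c: "c \<in> corr_coords n" and e: "e \<in> upper_indices n"
  shows "\<bar>c e\<bar> \<le> 1"
proof -
  obtain p q where pq: "e = (p, q)" "p < q" "q < n" using e by (auto simp: upper_indices_def)
  have "0 \<le> corr_form n c v" for v using c by (auto simp: corr_coords_def)
  from this[of "\<lambda>i. if i = p then 1 else if i = q then 1 else 0"]
       this[of "\<lambda>i. if i = p then 1 else if i = q then - 1 else 0"]
  show ?thesis
    using pq(2,3) by (auto simp: corr_form_single_pair pq(1))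
qed

text \<open>Diagonal dominance: such small off-diagonal entries cannot outweigh the unit diagonal.
  The box obtained this way shows that the set has positive volume.\<close>

lemma corr_coords_box:
  assumes c: "c \<in> extensional (upper_indices n)" and n: "0 < n"
    and small: "\<And>e. e \<in> upper_indices n \<Longrightarrow> \<bar>c e\<bar> \<le> 1 / real n"
  shows "c \<in> corr_coords n"
proof -
  have "0 \<le> corr_form n c v" for v
  proof -
    \<comment> \<open>Off the diagonal this is the bound 1/n on the entry combined with AM-GM for
      the product of \<open>v i\<close> and \<open>v j\<close>. The diagonal terms are weakened to
      match, so that the lower bounds sum to exactly 0.\<close>
    have le: "(if i = j then (v i)\<^sup>2 else 0) - ((v i)\<^sup>2 + (v j)\<^sup>2) / (2 * real n) \<le> entry c i j * v i * v j"
      if "i < n" "j < n" for i j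
    proof (cases "i = j")
      case True
      then show ?thesis by (simp add: entry_def power2_eq_square)
    next
      case False
      have "\<bar>entry c i j\<bar> \<le> 1 / real n"
        using that False by (auto simp: entry_def upper_indices_def intro!: small)
      moreover have "\<bar>v i * v j\<bar> \<le> ((v i)\<^sup>2 + (v j)\<^sup>2) / 2"
        using sum_squares_bound[of "\<bar>v i\<bar>" "\<bar>v j\<bar>"] by (simp add: abs_mult)
      ultimately have "\<bar>entry c i j\<bar> * \<bar>v i * v j\<bar> \<le> (1 / real n) * (((v i)\<^sup>2 + (v j)\<^sup>2) / 2)"
        by (intro mult_mono) auto
      then have "\<bar>entry c i j * v i * v j\<bar> \<le> ((v i)\<^sup>2 + (v j)\<^sup>2) / (2 * real n)"
        by (simp add: abs_mult mult.assoc field_simps)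
      then show ?thesis using False by (simp add: abs_le_iff)
    qed
    have "(\<Sum>i<n. \<Sum>j<n. ((v i)\<^sup>2 + (v j)\<^sup>2) / (2 * real n)) = (\<Sum>i<n. (v i)\<^sup>2)"
      using n by (simp add: sum.distrib sum_divide_distrib[symmetric] sum_distrib_left[symmetric] field_simps)
    then have "0 = (\<Sum>i<n. \<Sum>j<n. (if i = j then (v i)\<^sup>2 else 0) - ((v i)\<^sup>2 + (v j)\<^sup>2) / (2 * real n))"
      by (simp add: sum_subtractf)
    also have "\<dots> \<le> corr_form n c v"
      unfolding corr_form_def by (intro sum_mono le) auto
    finally show ?thesis .
  qed
  then show ?thesis using c by (simp add: corr_coords_def)
qed

text \<open>Only countably many conditions remain, which makes the set of correlation matrices measurable.\<close>

lemma corr_form_nonneg_int: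
  assumes "\<And>l :: int list. 0 \<le> corr_form n c (\<lambda>i. of_int (l ! i))"
  shows "0 \<le> corr_form n c v"
proof -
  \<comment> \<open>Rounding \<open>v\<close> down to multiples of 1/m reduces to integer vectors,
    as the form is homogeneous of degree 2; continuity then recovers \<open>v\<close>. For m = 0,
    division by zero makes \<open>u m\<close> the zero vector, which is harmless.\<close>
  define u where "u m i = of_int \<lfloor>real m * v i\<rfloor> / real m" for m :: nat and i
  have pos: "0 \<le> corr_form n c (u m)" for m
  proof -
    have "corr_form n c (\<lambda>i. of_int (map (\<lambda>i. \<lfloor>real m * v i\<rfloor>) [0..<n] ! i))
        = corr_form n c (\<lambda>i. of_int \<lfloor>real m * v i\<rfloor>)"
      unfolding corr_form_def by (intro sum.cong) auto
    moreover have "corr_form n c (u m) = corr_form n c (\<lambda>i. of_int \<lfloor>real m * v i\<rfloor>) / (real m)\<^sup>2"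
      unfolding corr_form_def u_def by (simp add: sum_divide_distrib power2_eq_square)
    ultimately show ?thesis
      using assms[of "map (\<lambda>i. \<lfloor>real m * v i\<rfloor>) [0..<n]"] by simp
  qed
  have "(\<lambda>m. u m i) \<longlonglongrightarrow> v i" for i
  proof (rule real_tendsto_sandwich)
    show "\<forall>\<^sub>F m in sequentially. v i - 1 / real m \<le> u m i"
      using eventually_gt_at_top[of 0]
    proof eventually_elim
      case (elim m)
      have "real m * v i - 1 \<le> of_int \<lfloor>real m * v i\<rfloor>" by linarith
      then have "(real m * v i - 1) / real m \<le> u m i"
        unfolding u_def by (rule divide_right_mono) simp
      then show ?case using elim by (simp add: diff_divide_distrib)
    qed
    show "\<forall>\<^sub>F m in sequentially. u m i \<le> v i"
      using eventually_gt_at_top[of 0]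
      by eventually_elim (simp add: u_def field_simps)
    show "(\<lambda>m. v i - 1 / real m) \<longlonglongrightarrow> v i"
      using tendsto_diff[OF tendsto_const lim_1_over_n, of "v i"] by simp
  qed simp
  then have "(\<lambda>m. corr_form n c (u m)) \<longlonglongrightarrow> corr_form n c v"
    unfolding corr_form_def by (intro tendsto_intros)
  then show ?thesis
    by (rule tendsto_lowerbound) (auto simp: pos)
qed

lemma sets_corr_coords [measurable]:
  "corr_coords n \<in> sets (Pi\<^sub>M (upper_indices n) (\<lambda>_. lborel))"
proof -
  let ?P = "Pi\<^sub>M (upper_indices n) (\<lambda>_. lborel :: real measure)"
  \<comment> \<open>The type \<open>int list\<close> is countable, so the set is a countable
    intersection of measurable sets.\<close>
  have eq: "corr_coords n = {c \<in> space ?P. \<forall>l :: int list. 0 \<le> corr_form n c (\<lambda>i. of_int (l ! i))}"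
    by (auto simp: corr_coords_def space_PiM PiE_UNIV_domain PiE_def intro: corr_form_nonneg_int)
  have ent: "(\<lambda>c. entry c i j) \<in> borel_measurable ?P" if "i < n" "j < n" for i j
  proof (cases "i = j")
    case False
    then have "(min i j, max i j) \<in> upper_indices n" using that by (auto simp: upper_indices_def)
    from measurable_component_singleton[OF this, of "\<lambda>_. lborel :: real measure"]
    show ?thesis using False by (simp add: entry_def)
  qed (simp add: entry_def)
  have [measurable]: "(\<lambda>c. corr_form n c v) \<in> borel_measurable ?P" for v
    unfolding corr_form_def by (intro borel_measurable_sum borel_measurable_times ent) auto
  show ?thesis unfolding eq by measurable
qed

section \<open>Slices with one entry fixed\<close>

text \<open>With a = sqrt (1 - y^2), the congruence of \<open>sum_row_operation\<close> turns the
  entry 0 at (p, q) into y * 1 + a * 0 = y and keeps the diagonal entry at q equal to y^2 + a^2 = 1.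
  The other entries of row q form \<open>K\<close>, and \<open>\<phi>\<close> replaces q by p in an
  index pair. Since a > 0 the congruence is invertible, which gives both directions.\<close>

lemma corr_coords_shear_iff:
  fixes x :: "nat \<times> nat \<Rightarrow> real"
  assumes pq: "p < q" "q < n" and y: "\<bar>y\<bar> < 1"
    and J: "J = upper_indices n - {(p, q)}"
    and K: "K = {e \<in> J. fst e = q \<or> snd e = q}"
    and \<phi>: "\<And>e. \<phi> e = (let k = if fst e = q then snd e else fst e in (min p k, max p k))"
    and x: "x \<in> extensional J"
  shows "(\<lambda>e. if e \<in> K then sqrt (1 - y\<^sup>2) * x e + y * x (\<phi> e) else x e)((p, q) := y) \<in> corr_coords n
     \<longleftrightarrow> x((p, q) := 0) \<in> corr_coords n" (is "?c' \<in> _ \<longleftrightarrow> ?c \<in> _")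
proof -
  define a where "a = sqrt (1 - y\<^sup>2)"
  have a: "0 < a" "a\<^sup>2 = 1 - y\<^sup>2"
    using y by (auto simp: a_def abs_square_less_1 abs_square_le_1 less_imp_le)
  have form: "corr_form n ?c' v = corr_form n ?c (v(p := v p + y * v q, q := a * v q))" for v
    unfolding corr_form_def
  proof (rule sum_row_operation)
    show "p < n" "q < n" "p \<noteq> q" using pq by auto
    show "entry ?c' i j = entry ?c i j" if "i < n" "j < n" "i \<noteq> q" "j \<noteq> q" for i j
      using that pq by (auto simp: entry_def K min_def max_def)
    show "entry ?c' q j = y * entry ?c p j + a * entry ?c q j" if j: "j < n" "j \<noteq> q" for j
    proof (cases "j = p")
      case True
      then show ?thesis using pq by (simp add: entry_def)
    next
      case False
      define e f where "e = (min q j, max q j)" and "f = (min p j, max p j)"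
      have "e \<in> K"
        using j pq False by (auto simp: e_def K J upper_indices_def min_def max_def)
      moreover have "\<phi> e = f"
        using j by (auto simp: e_def f_def \<phi> min_def max_def)
      moreover have "e \<noteq> (p, q)" "f \<noteq> (p, q)"
        using j False pq by (auto simp: e_def f_def min_def max_def)
      moreover have "entry c q j = c e" "entry c p j = c f" for c
        using j False by (auto simp: entry_def e_def f_def)
      ultimately show ?thesis
        by (simp add: a_def)
    qed
    show "entry ?c' q q = y\<^sup>2 * entry ?c p p + 2 * a * y * entry ?c p q + a\<^sup>2 * entry ?c q q"
      using pq a by (simp add: entry_def)
  qed (rule entry_commute)+
  have "(\<forall>v. 0 \<le> corr_form n ?c' v) \<longleftrightarrow> (\<forall>v. 0 \<le> corr_form n ?c v)"
  proof
    assume R: "\<forall>v. 0 \<le> corr_form n ?c' v"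
    show "\<forall>v. 0 \<le> corr_form n ?c v"
    proof
      fix w
      \<comment> \<open>The preimage of \<open>w\<close> under the substitution, which exists
        because \<open>a\<close> is nonzero.\<close>
      define v where "v = w(p := w p - y * (w q / a), q := w q / a)"
      have w: "v(p := v p + y * v q, q := a * v q) = w"
        using pq a(1) by (auto simp: v_def fun_eq_iff)
      have "0 \<le> corr_form n ?c' v" using R by (rule spec)
      then show "0 \<le> corr_form n ?c w" unfolding form w .
    qed
  next
    assume "\<forall>v. 0 \<le> corr_form n ?c v"
    then show "\<forall>v. 0 \<le> corr_form n ?c' v" unfolding form by blast
  qed
  moreover have "K \<subseteq> J" "J \<subseteq> upper_indices n" "(p, q) \<in> upper_indices n"
    using pq by (auto simp: J K upper_indices_def)
  then have "?c' \<in> extensional (upper_indices n)" "?c \<in> extensional (upper_indices n)"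
    using x by (auto simp: extensional_def)
  ultimately show ?thesis by (simp add: corr_coords_def)
qed

definition slice_volume :: "nat \<Rightarrow> nat \<times> nat \<Rightarrow> real \<Rightarrow> ennreal" where
  "slice_volume n e y =
    (\<integral>\<^sup>+x. indicator (corr_coords n) (x(e := y)) \<partial>lebesgue_prod (upper_indices n - {e}))"

text \<open>The shear maps the slice at 0 onto the slice at y and rescales one coordinate for each
  element of \<open>K\<close>, so the factor is sqrt (1 - y^2) to the power
  \<open>card K\<close>.\<close>

lemma slice_volume_eq:
  assumes pq: "p < q" "q < n" and y: "\<bar>y\<bar> < 1"
  shows "slice_volume n (p, q) y = ennreal (sqrt (1 - y\<^sup>2) ^ (n - 2)) * slice_volume n (p, q) 0"
proof -
  define J where "J = upper_indices n - {(p, q)}"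
  define K where "K = {e \<in> J. fst e = q \<or> snd e = q}"
  define \<phi> where "\<phi> e = (let k = if fst e = q then snd e else fst e in (min p k, max p k))" for e
  define g :: "(nat \<times> nat \<Rightarrow> real) \<Rightarrow> ennreal"
    where "g x = indicator (corr_coords n) (x((p, q) := y))" for x
  have ins: "insert (p, q) J = upper_indices n" using pq by (auto simp: J_def upper_indices_def)
  have a: "0 < sqrt (1 - y\<^sup>2)" using y by (simp add: abs_square_less_1)
  have g: "g \<in> borel_measurable (lebesgue_prod J)"
  proof -
    have "(\<lambda>x. x((p, q) := y)) \<in> measurable (lebesgue_prod J) (lebesgue_prod (upper_indices n))"
      by (rule measurable_fun_upd[where J = J]) (use ins in auto)
    then show ?thesis unfolding g_def
      by (rule measurable_compose) (simp add: sets_corr_coords)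
  qed
  \<comment> \<open>An element of \<open>K\<close> is determined by the index \<open>k\<close>
    paired with \<open>q\<close>; both \<open>q\<close> and \<open>p\<close> are excluded, which
    leaves n - 2 choices.\<close>
  have "K = (\<lambda>k. (min q k, max q k)) ` ({..<n} - {p, q})"
  proof (intro equalityI subsetI)
    fix e assume "e \<in> K"
    then have "e = (\<lambda>k. (min q k, max q k)) (if fst e = q then snd e else fst e)"
         "(if fst e = q then snd e else fst e) \<in> {..<n} - {p, q}"
      using pq by (auto simp: K_def J_def upper_indices_def)
    then show "e \<in> (\<lambda>k. (min q k, max q k)) ` ({..<n} - {p, q})" by (rule image_eqI)
  next
    fix e assume "e \<in> (\<lambda>k. (min q k, max q k)) ` ({..<n} - {p, q})"
    then obtain k where "k < n" "k \<noteq> p" "k \<noteq> q" "e = (min q k, max q k)" by auto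
    then show "e \<in> K"
      using pq by (cases k q rule: linorder_cases) (auto simp: K_def J_def upper_indices_def)
  qed
  moreover have "inj_on (\<lambda>k. (min q k, max q k)) ({..<n} - {p, q})"
    by (auto simp: inj_on_def min_def max_def split: if_splits)
  ultimately have card_K: "card K = n - 2"
    using pq by (simp add: card_image card_Diff_subset)
  have "ennreal (sqrt (1 - y\<^sup>2)) ^ card K *
      (\<integral>\<^sup>+x. g (\<lambda>e. if e \<in> K then sqrt (1 - y\<^sup>2) * x e + y * x (\<phi> e) else x e) \<partial>lebesgue_prod J)
    = (\<integral>\<^sup>+x. g x \<partial>lebesgue_prod J)"
  proof (rule nn_integral_shear[OF _ _ _ _ a g])
    show "\<phi> e \<in> J - K" if "e \<in> K" for e
      using that pq by (auto simp: K_def J_def upper_indices_def \<phi>_def Let_def min_def max_def split: if_splits)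
  qed (auto simp: K_def J_def)
  also have "(\<integral>\<^sup>+x. g (\<lambda>e. if e \<in> K then sqrt (1 - y\<^sup>2) * x e + y * x (\<phi> e) else x e) \<partial>lebesgue_prod J)
    = (\<integral>\<^sup>+x. indicator (corr_coords n) (x((p, q) := 0)) \<partial>lebesgue_prod J)"
  proof (rule nn_integral_cong)
    fix x assume "x \<in> space (lebesgue_prod J)"
    then have "x \<in> extensional J" by (simp add: space_PiM PiE_def)
    from corr_coords_shear_iff[OF pq y J_def K_def \<phi>_def this]
    show "g (\<lambda>e. if e \<in> K then sqrt (1 - y\<^sup>2) * x e + y * x (\<phi> e) else x e)
        = indicator (corr_coords n) (x((p, q) := 0))"
      by (simp add: g_def indicator_def)
  qed
  finally show ?thesis
    unfolding card_K slice_volume_def J_def g_def using a by (simp add: ennreal_power)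
qed

text \<open>Tonelli with the entry at (p, q) integrated outermost. The shear degenerates at y = 1
  and y = -1, but these two points form a null set, and the slices beyond them are empty. The slice
  volume at 0 is never computed; it cancels when two such measures are compared.\<close>

lemma emeasure_corr_coords_entry:
  assumes pq: "p < q" "q < n" and A: "A \<in> sets borel"
  shows "emeasure (lebesgue_prod (upper_indices n)) {c \<in> corr_coords n. c (p, q) \<in> A}
       = slice_volume n (p, q) 0 *
         (\<integral>\<^sup>+y. indicator (A \<inter> {-1<..<1}) y * ennreal (sqrt (1 - y\<^sup>2) ^ (n - 2)) \<partial>lborel)"
proof -
  define J where "J = upper_indices n - {(p, q)}"
  have ins: "insert (p, q) J = upper_indices n" using pq by (auto simp: J_def upper_indices_def)
  have J: "finite J" "(p, q) \<notin> J" by (auto simp: J_def)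
  have upq: "(p, q) \<in> upper_indices n" using pq by (simp add: upper_indices_def)
  define S where "S = {c \<in> corr_coords n. c (p, q) \<in> A}"
  have S: "S \<in> sets (lebesgue_prod (upper_indices n))"
  proof -
    have [measurable]: "(\<lambda>c. c (p, q)) \<in> borel_measurable (lebesgue_prod (upper_indices n))"
      using measurable_component_singleton[OF upq, of "\<lambda>_. lborel :: real measure"] by simp
    note A[measurable] sets_corr_coords[measurable]
    have "S = corr_coords n \<inter> {c \<in> space (lebesgue_prod (upper_indices n)). c (p, q) \<in> A}"
      using sets.sets_into_space[OF sets_corr_coords, of n] by (auto simp: S_def)
    also have "\<dots> \<in> sets (lebesgue_prod (upper_indices n))" by measurable
    finally show ?thesis .
  qed
  have "emeasure (lebesgue_prod (upper_indices n)) S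
      = (\<integral>\<^sup>+c. indicator S c \<partial>lebesgue_prod (insert (p, q) J))"
    using S by (simp add: ins)
  also have "\<dots> = (\<integral>\<^sup>+y. \<integral>\<^sup>+x. indicator S (x((p, q) := y)) \<partial>lebesgue_prod J \<partial>lborel)"
    by (rule lborel_prod.product_nn_integral_insert_rev[OF J]) (use S ins in simp)
  also have "\<dots> = (\<integral>\<^sup>+y. slice_volume n (p, q) 0 *
      (indicator (A \<inter> {-1<..<1}) y * ennreal (sqrt (1 - y\<^sup>2) ^ (n - 2))) \<partial>lborel)"
  proof (rule nn_integral_cong_AE)
    show "AE y in lborel. (\<integral>\<^sup>+x. indicator S (x((p, q) := y)) \<partial>lebesgue_prod J)
      = slice_volume n (p, q) 0 * (indicator (A \<inter> {-1<..<1}) y * ennreal (sqrt (1 - y\<^sup>2) ^ (n - 2)))"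
      using AE_lborel_singleton[of "1 :: real"] AE_lborel_singleton[of "-1 :: real"]
    proof eventually_elim
      case (elim y)
      consider "y \<notin> A" | "y \<in> A" "\<bar>y\<bar> < 1" | "1 < \<bar>y\<bar>" using elim by fastforce
      then show ?case
      proof cases
        case 1
        then have "indicator S (x((p, q) := y)) = (0 :: ennreal)" for x by (simp add: S_def)
        then show ?thesis using 1 by simp
      next
        case 2
        then have "indicator S (x((p, q) := y)) = (indicator (corr_coords n) (x((p, q) := y)) :: ennreal)" for x
          by (simp add: S_def indicator_def)
        then have "(\<integral>\<^sup>+x. indicator S (x((p, q) := y)) \<partial>lebesgue_prod J) = slice_volume n (p, q) y"
          by (simp add: slice_volume_def J_def)
        then show ?thesis
          using 2 slice_volume_eq[OF pq 2(2)] by (simp add: abs_less_iff mult.commute)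
      next
        case 3
        then have "x((p, q) := y) \<notin> S" for x
          using corr_coords_abs_le_1[OF _ upq, of "x((p, q) := y)"] by (auto simp: S_def)
        then have "indicator S (x((p, q) := y)) = (0 :: ennreal)" for x by simp
        then show ?thesis using 3 by (auto simp: indicator_def)
      qed
    qed
  qed
  also have "\<dots> = slice_volume n (p, q) 0 *
         (\<integral>\<^sup>+y. indicator (A \<inter> {-1<..<1}) y * ennreal (sqrt (1 - y\<^sup>2) ^ (n - 2)) \<partial>lborel)"
    using A by (intro nn_integral_cmult borel_measurable_times_ennreal borel_measurable_indicator) auto
  finally show ?thesis by (simp add: S_def)
qed

section \<open>Bounds for the one-dimensional integral\<close>

text \<open>On the interval from \<open>r\<close> to \<open>r + (1 - r) / n\<close> the integrand loses at most the factor
  \<open>(1 - 1 / n) ^ (n - 2)\<close>, which Bernoulli's inequality bounds below by \<open>2 / n\<close>.\<close>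

lemma nn_integral_sqrt_power_ge:
  assumes n: "2 \<le> n" and r: "0 \<le> r" "r < 1"
  shows "ennreal (2 * (1 - r) / (real n)\<^sup>2 * sqrt (1 - r\<^sup>2) ^ (n - 2))
    \<le> (\<integral>\<^sup>+y. indicator ({y. r < \<bar>y\<bar>} \<inter> {-1<..<1}) y * ennreal (sqrt (1 - y\<^sup>2) ^ (n - 2)) \<partial>lborel)"
proof -
  define t where "t = 1 / real n"
  define s where "s = r + t * (1 - r)"
  have t: "0 < t" "t \<le> 1/2" using n by (auto simp: t_def field_simps)
  have "1 - s = (1 - t) * (1 - r)" by (simp add: s_def algebra_simps)
  moreover have "0 < (1 - t) * (1 - r)" using t r by (intro mult_pos_pos) auto
  ultimately have "s < 1" by linarith
  moreover have "r < s" using t r by (simp add: s_def)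
  ultimately have s: "r < s" "s < 1" by simp_all
  define m where "m = sqrt (1 - r\<^sup>2) * (1 - t)"
  have r1: "0 \<le> 1 - r\<^sup>2" using r by (simp add: abs_square_le_1)
  have m0: "0 \<le> m" using t r1 by (simp add: m_def)
  have m: "m \<le> sqrt (1 - y\<^sup>2)" if "r < y" "y < s" for y
  proof (rule real_le_rsqrt)
    have "m\<^sup>2 = (1 - r\<^sup>2) * (1 - t)\<^sup>2" using r1 by (simp add: m_def power_mult_distrib)
    \<comment> \<open>Giving up one factor 1 - t leaves a product that splits as (1 - s)(1 + r),
      which compares factor by factor with (1 - y)(1 + y).\<close>
    also have "\<dots> \<le> (1 - r\<^sup>2) * (1 - t)"
      using r1 t by (intro mult_left_mono) (auto simp: power2_eq_square mult_left_le)
    also have "\<dots> = (1 - s) * (1 + r)" by (simp add: s_def power2_eq_square algebra_simps)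
    also have "\<dots> \<le> (1 - y) * (1 + y)"
      using that r s by (intro mult_mono) auto
    finally show "m\<^sup>2 \<le> 1 - y\<^sup>2" by (simp add: power2_eq_square algebra_simps)
  qed
  have "2 * t = 1 + real (n - 2) * (- t)"
    using n by (simp add: t_def of_nat_diff field_simps)
  also have "\<dots> \<le> (1 - t) ^ (n - 2)"
    using Bernoulli_inequality[of "- t" "n - 2"] t by simp
  finally have bern: "2 * t \<le> (1 - t) ^ (n - 2)" .
  \<comment> \<open>One factor 1/n is the \<open>t\<close> from Bernoulli's inequality, the other
    comes from the interval length \<open>s - r\<close>.\<close>
  have "2 * (1 - r) / (real n)\<^sup>2 * sqrt (1 - r\<^sup>2) ^ (n - 2)
      = (2 * t) * (sqrt (1 - r\<^sup>2) ^ (n - 2) * (s - r))"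
    by (simp add: t_def s_def power2_eq_square)
  also have "\<dots> \<le> (1 - t) ^ (n - 2) * (sqrt (1 - r\<^sup>2) ^ (n - 2) * (s - r))"
    using bern r1 s by (intro mult_right_mono) auto
  also have "\<dots> = m ^ (n - 2) * (s - r)"
    by (simp add: m_def power_mult_distrib)
  finally have "ennreal (2 * (1 - r) / (real n)\<^sup>2 * sqrt (1 - r\<^sup>2) ^ (n - 2)) \<le> ennreal (m ^ (n - 2) * (s - r))"
    by (rule ennreal_leI)
  also have "\<dots> = (\<integral>\<^sup>+y. ennreal (m ^ (n - 2)) * indicator {r<..<s} y \<partial>lborel)"
    using s m0 by (simp add: nn_integral_cmult_indicator ennreal_mult)
  also have "\<dots> \<le> (\<integral>\<^sup>+y. indicator ({y. r < \<bar>y\<bar>} \<inter> {-1<..<1}) y * ennreal (sqrt (1 - y\<^sup>2) ^ (n - 2)) \<partial>lborel)"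
  proof (rule nn_integral_mono)
    fix y :: real
    show "ennreal (m ^ (n - 2)) * indicator {r<..<s} y
      \<le> indicator ({y. r < \<bar>y\<bar>} \<inter> {-1<..<1}) y * ennreal (sqrt (1 - y\<^sup>2) ^ (n - 2))"
    proof (cases "y \<in> {r<..<s}")
      case True
      then have "m ^ (n - 2) \<le> sqrt (1 - y\<^sup>2) ^ (n - 2)" using m m0 by (intro power_mono) auto
      then have "ennreal (m ^ (n - 2)) \<le> ennreal (sqrt (1 - y\<^sup>2) ^ (n - 2))"
        by (rule ennreal_leI)
      then show ?thesis using True r s by simp
    qed simp
  qed
  finally show ?thesis .
qed

text \<open>The integrand decreases in the modulus of y, so its value at r bounds it on A; the
  interval has length 2.\<close>

lemma nn_integral_sqrt_power_le:
  assumes r: "0 \<le> r" "r \<le> 1" "\<And>y. y \<in> A \<Longrightarrow> r \<le> \<bar>y\<bar>"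
  shows "(\<integral>\<^sup>+y. indicator (A \<inter> {-1<..<1}) y * ennreal (sqrt (1 - y\<^sup>2) ^ m) \<partial>lborel)
    \<le> ennreal (2 * sqrt (1 - r\<^sup>2) ^ m)"
proof -
  have r1: "r\<^sup>2 \<le> 1" using r by (simp add: abs_square_le_1)
  have "(\<integral>\<^sup>+y. indicator (A \<inter> {-1<..<1}) y * ennreal (sqrt (1 - y\<^sup>2) ^ m) \<partial>lborel)
      \<le> (\<integral>\<^sup>+y. ennreal (sqrt (1 - r\<^sup>2) ^ m) * indicator {-1<..<1::real} y \<partial>lborel)"
  proof (rule nn_integral_mono)
    fix y :: real
    show "indicator (A \<inter> {-1<..<1}) y * ennreal (sqrt (1 - y\<^sup>2) ^ m)
        \<le> ennreal (sqrt (1 - r\<^sup>2) ^ m) * indicator {-1<..<1} y"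
    proof (cases "y \<in> A \<inter> {-1<..<1}")
      case True
      then have "r\<^sup>2 \<le> y\<^sup>2" using power_mono[OF r(3) r(1), of y 2] by simp
      moreover have "y\<^sup>2 \<le> 1" using True by (auto simp: abs_square_le_1)
      ultimately have "ennreal (sqrt (1 - y\<^sup>2) ^ m) \<le> ennreal (sqrt (1 - r\<^sup>2) ^ m)"
        by (intro power_mono ennreal_leI) auto
      then show ?thesis using True by simp
    qed simp
  qed
  also have "\<dots> = ennreal (2 * sqrt (1 - r\<^sup>2) ^ m)"
    using r1 by (subst nn_integral_cmult_indicator) (auto simp: ennreal_mult' mult.commute)
  finally show ?thesis .
qed

section \<open>Total volume and the tail of one entry\<close>

lemma emeasure_corr_coords_finite:
  "emeasure (lebesgue_prod (upper_indices n)) (corr_coords n) < \<infinity>"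
proof -
  have "emeasure (lebesgue_prod (upper_indices n)) (corr_coords n)
      \<le> emeasure (lebesgue_prod (upper_indices n)) (\<Pi>\<^sub>E e\<in>upper_indices n. {-1..1})"
  proof (rule emeasure_mono)
    show "corr_coords n \<subseteq> (\<Pi>\<^sub>E e\<in>upper_indices n. {-1..1})"
    proof
      fix c assume c: "c \<in> corr_coords n"
      then have "c e \<in> {-1..1}" if "e \<in> upper_indices n" for e
        using corr_coords_abs_le_1[OF c that] by auto
      then show "c \<in> (\<Pi>\<^sub>E e\<in>upper_indices n. {-1..1})"
        using c by (simp add: PiE_iff corr_coords_def)
    qed
    show "(\<Pi>\<^sub>E e\<in>upper_indices n. {-1..1}) \<in> sets (lebesgue_prod (upper_indices n))"
      by (rule sets_PiM_I_finite) auto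
  qed
  also have "\<dots> = 2 ^ card (upper_indices n)"
    by (subst lborel_prod.emeasure_PiM) simp_all
  also have "\<dots> < \<infinity>"
    by (simp add: power_less_top_ennreal)
  finally show ?thesis .
qed

lemma emeasure_corr_coords_pos:
  assumes "0 < n"
  shows "0 < emeasure (lebesgue_prod (upper_indices n)) (corr_coords n)"
proof -
  have "0 < ennreal ((2 / real n) ^ card (upper_indices n))"
    using assms by simp
  also have "\<dots> = emeasure (lebesgue_prod (upper_indices n)) (\<Pi>\<^sub>E e\<in>upper_indices n. {-(1 / real n)..1 / real n})"
    by (subst lborel_prod.emeasure_PiM) (simp_all add: ennreal_power)
  also have "\<dots> \<le> emeasure (lebesgue_prod (upper_indices n)) (corr_coords n)"
    using assms sets_corr_coords
    by (intro emeasure_mono subsetI corr_coords_box) (auto simp: PiE_iff abs_le_iff minus_le_iff)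
  finally show ?thesis .
qed

text \<open>Both volumes are the same slice volume W times a one-dimensional integral, so W can be
  eliminated: V is at most 2W, and at least 2W/n^2 by the lower integral bound with r = 0.\<close>

lemma
  assumes pq: "p < q" "q < n" and r: "0 \<le> r" "r < 1"
  defines "V \<equiv> measure (lebesgue_prod (upper_indices n)) (corr_coords n)"
    and "P \<equiv> measure (lebesgue_prod (upper_indices n)) {c \<in> corr_coords n. r < \<bar>c (p, q)\<bar>}"
  shows measure_corr_coords_tail_ge: "(1 - r) / (real n)\<^sup>2 * sqrt (1 - r\<^sup>2) ^ (n - 2) * V \<le> P"
    and measure_corr_coords_tail_le: "P \<le> (real n)\<^sup>2 * sqrt (1 - r\<^sup>2) ^ (n - 2) * V"
proof -
  let ?M = "lebesgue_prod (upper_indices n)"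
  define a where "a = sqrt (1 - r\<^sup>2) ^ (n - 2)"
  define W where "W = slice_volume n (p, q) 0"
  have n: "2 \<le> n" using pq by simp
  have a: "0 \<le> a" using r by (simp add: a_def abs_square_le_1)
  define S where "S u = {c \<in> corr_coords n. u < \<bar>c (p, q)\<bar>}" for u
  have S_eq: "emeasure ?M (S u) = W * (\<integral>\<^sup>+y. indicator ({y. u < \<bar>y\<bar>} \<inter> {-1<..<1}) y *
      ennreal (sqrt (1 - y\<^sup>2) ^ (n - 2)) \<partial>lborel)" for u
    using emeasure_corr_coords_entry[OF pq, of "{y. u < \<bar>y\<bar>}"] by (simp add: S_def W_def)
  have S_le: "emeasure ?M (S u) \<le> emeasure ?M (corr_coords n)" for u
    by (rule emeasure_mono) (auto simp: S_def sets_corr_coords)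
  have V: "emeasure ?M (corr_coords n) = ennreal V"
    using emeasure_corr_coords_finite[of n] by (simp add: V_def emeasure_eq_ennreal_measure less_top)
  have P: "emeasure ?M (S r) = ennreal P"
    using le_less_trans[OF S_le emeasure_corr_coords_finite]
    by (simp add: P_def S_def emeasure_eq_ennreal_measure less_top)
  have V_ge: "W * ennreal (2 / (real n)\<^sup>2) \<le> ennreal V"
  proof -
    have "W * ennreal (2 / (real n)\<^sup>2) \<le> emeasure ?M (S 0)"
      unfolding S_eq using nn_integral_sqrt_power_ge[OF n, of 0] by (intro mult_left_mono) auto
    then show ?thesis using S_le[of 0] V by simp
  qed
  have V_le: "ennreal V \<le> W * 2"
  proof -
    have "ennreal V = W * (\<integral>\<^sup>+y. indicator (UNIV \<inter> {-1<..<1}) y *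
      ennreal (sqrt (1 - y\<^sup>2) ^ (n - 2)) \<partial>lborel)"
      using emeasure_corr_coords_entry[OF pq, of UNIV] V by (simp add: W_def)
    also have "\<dots> \<le> W * 2"
      using nn_integral_sqrt_power_le[of 0 UNIV "n - 2"] by (intro mult_left_mono) auto
    finally show ?thesis .
  qed
  have V0: "0 \<le> V" and P0: "0 \<le> P" by (auto simp: V_def P_def)
  have "ennreal ((1 - r) / (real n)\<^sup>2 * a * V) = ennreal ((1 - r) / (real n)\<^sup>2 * a) * ennreal V"
    using a r V0 by (intro ennreal_mult) auto
  also have "\<dots> \<le> ennreal ((1 - r) / (real n)\<^sup>2 * a) * (W * 2)"
    using V_le by (rule mult_left_mono) simp
  also have "\<dots> = W * ennreal (2 * (1 - r) / (real n)\<^sup>2 * a)"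
    using a r by (simp add: ennreal_mult[symmetric] ennreal_numeral[symmetric] mult_ac del: ennreal_numeral)
  also have "\<dots> \<le> ennreal P"
    unfolding P[symmetric] S_eq a_def
    using nn_integral_sqrt_power_ge[OF n r] by (intro mult_left_mono) auto
  finally show "(1 - r) / (real n)\<^sup>2 * sqrt (1 - r\<^sup>2) ^ (n - 2) * V \<le> P"
    using P0 by (simp add: a_def)
  have "ennreal P \<le> W * ennreal (2 * a)"
    unfolding P[symmetric] S_eq a_def
    using nn_integral_sqrt_power_le[of r "{y. r < \<bar>y\<bar>}" "n - 2"] r by (intro mult_left_mono) auto
  \<comment> \<open>The factor 2/n^2 is split off so that W times it can be replaced by V.\<close>
  also have "2 * a = (2 / (real n)\<^sup>2) * ((real n)\<^sup>2 * a)" using n by simp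
  also have "W * ennreal \<dots> = (W * ennreal (2 / (real n)\<^sup>2)) * ennreal ((real n)\<^sup>2 * a)"
    using a by (subst ennreal_mult) (auto simp: mult.assoc)
  also have "\<dots> \<le> ennreal V * ennreal ((real n)\<^sup>2 * a)"
    using V_ge by (rule mult_right_mono) simp
  also have "\<dots> = ennreal ((real n)\<^sup>2 * a * V)"
    using a V0 by (simp add: ennreal_mult[symmetric] mult.commute)
  finally show "P \<le> (real n)\<^sup>2 * sqrt (1 - r\<^sup>2) ^ (n - 2) * V"
    using a V0 by (simp add: a_def)
qed

section \<open>Union bound and asymptotics\<close>

lemma card_upper_indices_le: "card (upper_indices n) \<le> n\<^sup>2"
proof -
  have "card (upper_indices n) \<le> card ({..<n} \<times> {..<n})"
    by (rule card_mono) (auto simp: upper_indices_def)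
  then show ?thesis by (simp add: power2_eq_square)
qed

text \<open>The complement is the union \<open>U\<close> of the events that a given entry exceeds r
  in modulus. From below, the single entry (0, 1) is enough; from above, at most n^2 events of equal
  bound are summed, which raises n^2 to n^4.\<close>

lemma corr_vol_ratio_bounds:
  assumes n: "2 \<le> n" and r: "0 < r" "r < 1"
  defines "d \<equiv> 1 - corr_vol n (bounded_correlation_matrices n r) / corr_vol n (correlation_matrices n)"
  shows "(1 - r) / (real n)\<^sup>2 * sqrt (1 - r\<^sup>2) ^ (n - 2) \<le> d"
    and "d \<le> (real n) ^ 4 * sqrt (1 - r\<^sup>2) ^ (n - 2)"
proof -
  let ?M = "lebesgue_prod (upper_indices n)"
  define a where "a = sqrt (1 - r\<^sup>2) ^ (n - 2)"
  define V where "V = measure ?M (corr_coords n)"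
  define B where "B e = {c \<in> corr_coords n. r < \<bar>c e\<bar>}" for e
  define U where "U = (\<Union>e\<in>upper_indices n. B e)"
  have fin: "corr_coords n \<in> fmeasurable ?M"
    using emeasure_corr_coords_finite sets_corr_coords by (auto simp: fmeasurable_def)
  have V: "0 < V"
    using emeasure_corr_coords_pos[of n] n emeasure_corr_coords_finite[of n]
    by (simp add: V_def emeasure_eq_ennreal_measure less_top)
  have B: "B e \<in> fmeasurable ?M" if e: "e \<in> upper_indices n" for e
  proof -
    have [measurable]: "(\<lambda>c. c e) \<in> borel_measurable ?M"
      using measurable_component_singleton[OF e, of "\<lambda>_. lborel :: real measure"] by simp
    have "B e = corr_coords n \<inter> {c \<in> space ?M. r < \<bar>c e\<bar>}"
      using sets.sets_into_space[OF sets_corr_coords, of n] by (auto simp: B_def)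
    moreover have "{c \<in> space ?M. r < \<bar>c e\<bar>} \<in> sets ?M" by measurable
    ultimately show ?thesis using fmeasurable_Int_fmeasurable[OF fin] by simp
  qed
  have U: "U \<in> fmeasurable ?M" unfolding U_def by (rule fmeasurable.finite_UN) (auto simp: B)
  have "upper_coords n ` bounded_correlation_matrices n r = corr_coords n - U"
    unfolding upper_coords_bounded upper_coords_correlation by (auto simp: U_def B_def not_less)
  moreover have "U \<subseteq> corr_coords n" by (auto simp: U_def B_def)
  ultimately have "corr_vol n (bounded_correlation_matrices n r) = V - measure ?M U"
    using fin U by (simp add: corr_vol_def V_def measurable_measure_Diff)
  moreover have "corr_vol n (correlation_matrices n) = V"
    by (simp add: corr_vol_def V_def upper_coords_correlation)
  ultimately have d: "d = measure ?M U / V"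
    using V by (simp add: d_def field_simps)
  have "(1 - r) / (real n)\<^sup>2 * a * V \<le> measure ?M (B (0, 1))"
    using measure_corr_coords_tail_ge[of 0 1 n r] n r by (simp add: a_def V_def B_def)
  also have "\<dots> \<le> measure ?M U"
  proof (rule measure_mono_fmeasurable)
    have "(0, 1) \<in> upper_indices n" using n by (simp add: upper_indices_def)
    then show "B (0, 1) \<subseteq> U" "B (0, 1) \<in> sets ?M" using B by (auto simp: U_def)
  qed (rule U)
  finally show "(1 - r) / (real n)\<^sup>2 * sqrt (1 - r\<^sup>2) ^ (n - 2) \<le> d"
    using V by (simp add: d a_def pos_le_divide_eq)
  have a: "0 \<le> a" using r by (simp add: a_def abs_square_le_1)
  have "measure ?M U \<le> (\<Sum>e\<in>upper_indices n. measure ?M (B e))"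
    unfolding U_def by (rule measure_UNION_le) (use B in auto)
  also have "\<dots> \<le> (\<Sum>e\<in>upper_indices n. (real n)\<^sup>2 * a * V)"
    using measure_corr_coords_tail_le[of _ _ n r] r
    by (intro sum_mono) (auto simp: a_def V_def B_def upper_indices_def)
  also have "\<dots> = real (card (upper_indices n)) * ((real n)\<^sup>2 * a * V)" by simp
  also have "\<dots> \<le> (real n)\<^sup>2 * ((real n)\<^sup>2 * a * V)"
    using card_upper_indices_le[of n] a V
    by (intro mult_right_mono) (auto simp flip: of_nat_power)
  finally show "d \<le> (real n) ^ 4 * sqrt (1 - r\<^sup>2) ^ (n - 2)"
    using V by (simp add: d a_def pos_divide_le_eq mult_ac power2_eq_square power4_eq_xxxx)
qed

theorem proposition2:
  fixes r :: real
  assumes "0 < r" and "r < 1"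
  shows "(\<lambda>n::nat. ln (1 - corr_vol n (bounded_correlation_matrices n r) /
                            corr_vol n (correlation_matrices n))
                  - (- (real n / 2) * \<bar>ln (1 - r\<^sup>2)\<bar>))
         \<in> O(\<lambda>n. ln (real n))"
proof -
  define d where "d n = 1 - corr_vol n (bounded_correlation_matrices n r) /
    corr_vol n (correlation_matrices n)" for n
  define q where "q = 1 - r\<^sup>2"
  have q: "0 < q" "q < 1" using assms by (auto simp: q_def abs_square_less_1)
  \<comment> \<open>Collects the terms independent of n: ln (1 - r) from the lower bound, and ln q
    because the exponent is n - 2 instead of n.\<close>
  define c where "c = \<bar>ln (1 - r)\<bar> + \<bar>ln q\<bar>"
  have bound: "\<bar>ln (d n) - (- (real n / 2) * \<bar>ln q\<bar>)\<bar> \<le> (4 + c / ln 2) * \<bar>ln (real n)\<bar>"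
    if n: "2 \<le> n" for n
  proof -
    define a where "a = sqrt q ^ (n - 2)"
    have a: "0 < a" using q by (simp add: a_def)
    have ln_a: "ln a = real n / 2 * ln q - ln q"
      using q n by (simp add: a_def ln_realpow ln_sqrt of_nat_diff field_simps)
    have lo: "(1 - r) / (real n)\<^sup>2 * a \<le> d n" and hi: "d n \<le> real n ^ 4 * a"
      using corr_vol_ratio_bounds[OF n assms] by (auto simp: d_def a_def q_def)
    have pos: "0 < (1 - r) / (real n)\<^sup>2 * a" using assms n a by simp
    have "ln ((1 - r) / (real n)\<^sup>2 * a) \<le> ln (d n)" using lo pos by simp
    then have 1: "ln (1 - r) - 2 * ln (real n) + ln a \<le> ln (d n)"
      using assms n a by (simp add: ln_mult ln_div ln_realpow)
    have "ln (d n) \<le> ln (real n ^ 4 * a)" using lo hi pos by simp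
    then have 2: "ln (d n) \<le> 4 * ln (real n) + ln a"
      using n a by (simp add: ln_mult ln_realpow)
    have ln_n: "ln 2 \<le> ln (real n)" using n by simp
    have "0 \<le> c" by (simp add: c_def)
    \<comment> \<open>For n >= 2 a constant is at most a multiple of ln n, so \<open>c\<close> is
      absorbed as well.\<close>
    then have 3: "c \<le> c / ln 2 * ln (real n)"
      using mult_left_mono[OF ln_n, of "c / ln 2"] by simp
    \<comment> \<open>As ln q is negative, the term n/2 * ln q in \<open>ln_a\<close> cancels the
      claimed main term; the powers n^2 and n^4 then cost at most 4 * ln n.\<close>
    have "0 < ln (real n)" "ln q < 0" using n q by auto
    then have "\<bar>ln (d n) - (- (real n / 2) * \<bar>ln q\<bar>)\<bar> \<le> 4 * ln (real n) + c"
      using 1 2 unfolding ln_a c_def by (simp add: abs_if)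
    then show ?thesis
      using 3 \<open>0 < ln (real n)\<close> by (simp add: distrib_right)
  qed
  show ?thesis
    unfolding d_def[symmetric] q_def[symmetric]
    by (rule bigoI[where c = "4 + c / ln 2"], rule eventually_mono[OF eventually_ge_at_top[of 2]])
      (use bound in auto)
qed

end
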